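(* Let $(\overline{M},(\varphi_\alpha,\xi_\alpha,\eta_\alpha)_{\alpha=1,2,3},\overline{g})$ be a manifold endowed with a metric mixed 3-structure and let $M$ be an invariant submanifold of $\overline{M}$. Then either all three structure vector fields $\xi_1,\xi_2,\xi_3$ are tangent to $M$, or all three are normal to $M$.
   Context: Set $\tau_1=\tau_2=-1$, $\tau_3=1$. A mixed 3-structure on a smooth manifold $\overline{M}$ is a triple $(\varphi_\alpha,\xi_\alpha,\eta_\alpha)$, $\alpha=1,2,3$, where $\varphi_\alpha$ is a $(1,1)$-tensor field, $\xi_\alpha$ a vector field, $\eta_\alpha$ a 1-form, such that $\varphi_\alpha^2=\tau_\alpha(-I+\eta_\alpha\otimes\xi_\alpha)$, $\eta_\alpha(\xi_\alpha)=1$ (hence $\varphi_\alpha\xi_\alpha=0$, $\eta_\alpha\circ\varphi_\alpha=0$), and for every even permutation $(\alpha,\beta,\gamma)$ of $(1,2,3)$: $\eta_\alpha(\xi_\beta)=\eta_\beta(\xi_\alpha)=0$; $\varphi_\alpha(\xi_\beta)=\tau_\beta\xi_\gamma$, $\varphi_\beta(\xi_\alpha)=-\tau_\alpha\xi_\gamma$; $\eta_\alpha\circ\varphi_\beta=-\eta_\beta\circ\varphi_\alpha=\tau_\gamma\eta_\gamma$; $\varphi_\alpha\varphi_\beta-\tau_\alpha\eta_\beta\otimes\xi_\alpha=-\varphi_\beta\varphi_\alpha+\tau_\beta\eta_\alpha\otimes\xi_\beta=\tau_\gamma\varphi_\gamma$. It is a metric mixed 3-structure if in addition there is given a semi-Riemannian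 metric $\overline{g}$ with $\overline{g}(\varphi_\alpha X,\varphi_\alpha Y)=\tau_\alpha[\overline{g}(X,Y)-\varepsilon_\alpha\eta_\alpha(X)\eta_\alpha(Y)]$ for all $X,Y$ and $\alpha=1,2,3$, where $\varepsilon_\alpha=\overline{g}(\xi_\alpha,\xi_\alpha)=\pm1$. Consequently $\eta_\alpha(X)=\varepsilon_\alpha\overline{g}(X,\xi_\alpha)$ and $\overline{g}(\varphi_\alpha X,Y)=-\overline{g}(X,\varphi_\alpha Y)$. All submanifolds $M$ are immersed and non-degenerate (the restriction of $\overline g$ to $TM$ is non-degenerate), so $T\overline{M}|_M=TM\oplus TM^\perp$. $M$ is invariant if $\varphi_\alpha(T_pM)\subset T_pM$ for all $p\in M$, $\alpha=1,2,3$. A structure vector field $\xi_\alpha$ is tangent (resp. normal) to $M$ if $\xi_{\alpha,p}\in T_pM$ (resp. $T_pM^\perp$) for all $p\in M$. *)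

theory Defs
  imports "HOL-Analysis.Analysis" "HOL-Library.Function_Algebras"
begin

section \<open>Preliminaries\<close>

text \<open>The model spaces of manifolds are the finite-dimensional real normed spaces. In contrast to
  \<^class>\<open>euclidean_space\<close>, this class does not exclude dimension 0.\<close>

class finite_dim_normed_vector = real_normed_vector +
  assumes finite_dim: "\<exists>B. finite B \<and> (\<forall>x. \<exists>r. x = (\<Sum>b\<in>B. r b *\<^sub>R b))"

instance euclidean_space \<subseteq> finite_dim_normed_vector
proof
  show "\<exists>B::'a set. finite B \<and> (\<forall>x. \<exists>r. x = (\<Sum>b\<in>B. r b *\<^sub>R b))"
    by (metis euclidean_representation finite_Basis)
qed

instantiation "fun" :: (type, scaleR) scaleR
begin

definition scaleR_fun :: "real \<Rightarrow> ('a \<Rightarrow> 'b) \<Rightarrow> 'a \<Rightarrow> 'b"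
  where "scaleR_fun r f = (\<lambda>x. r *\<^sub>R f x)"

instance ..

end

instance "fun" :: (type, real_vector) real_vector
  by standard (auto simp: scaleR_fun_def plus_fun_def algebra_simps)

text \<open>Linearity of a map that is only relevant on a subspace.\<close>

definition linear_on :: "'a::real_vector set \<Rightarrow> ('a \<Rightarrow> 'b::real_vector) \<Rightarrow> bool"
  where "linear_on V f \<longleftrightarrow>
    (\<forall>v\<in>V. \<forall>w\<in>V. f (v + w) = f v + f w) \<and> (\<forall>r. \<forall>v\<in>V. f (r *\<^sub>R v) = r *\<^sub>R f v)"

text \<open>Only used for open \<open>S\<close>. As the domain is finite-dimensional, continuity of all iterated
  directional derivatives amounts to continuity of the iterated Frechet derivatives.\<close>

primrec C_k_on ::
    "nat \<Rightarrow> 'a::finite_dim_normed_vector set \<Rightarrow> ('a \<Rightarrow> 'b::real_normed_vector) \<Rightarrow> bool"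
  where
    "C_k_on 0 S f \<longleftrightarrow> continuous_on S f"
  | "C_k_on (Suc k) S f \<longleftrightarrow>
      (\<forall>x\<in>S. f differentiable (at x)) \<and> (\<forall>v. C_k_on k S (\<lambda>x. frechet_derivative f (at x) v))"

definition smooth_on ::
    "'a::finite_dim_normed_vector set \<Rightarrow> ('a \<Rightarrow> 'b::real_normed_vector) \<Rightarrow> bool"
  where "smooth_on S f \<longleftrightarrow> (\<forall>k. C_k_on k S f)"


section \<open>Smooth manifolds\<close>

record ('a, 'e) chart =
  cdom :: "'a set"
  coord :: "'a \<Rightarrow> 'e"

definition chart_inv :: "('a, 'e) chart \<Rightarrow> 'e \<Rightarrow> 'a"
  where "chart_inv c = inv_into (cdom c) (coord c)"

definition is_chart :: "'a topology \<Rightarrow> ('a, 'e::finite_dim_normed_vector) chart \<Rightarrow> bool"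
  where "is_chart X c \<longleftrightarrow> openin X (cdom c) \<and> open (coord c ` cdom c) \<and>
    homeomorphic_map (subtopology X (cdom c)) (top_of_set (coord c ` cdom c)) (coord c)"

locale smooth_manifold =
  fixes X :: "'a topology" and A :: "('a, 'e::finite_dim_normed_vector) chart set"
  assumes Hausdorff: "Hausdorff_space X"
    and second_countable: "second_countable X"
    and charts: "c \<in> A \<Longrightarrow> is_chart X c"
    and covering: "(\<Union>c\<in>A. cdom c) = topspace X"
    and compatible: "c \<in> A \<Longrightarrow> d \<in> A \<Longrightarrow>
      smooth_on (coord c ` (cdom c \<inter> cdom d)) (coord d \<circ> chart_inv c)"

text \<open>A tangent vector at \<open>p\<close> is given by its components with respect to all charts of the atlas
  around \<open>p\<close>, which are related by the derivatives of the coordinate changes; it is normalised to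
  be 0 on all other charts. Tangent vectors are added and scaled componentwise.\<close>

type_synonym ('a, 'e) tvec = "('a, 'e) chart \<Rightarrow> 'e"

definition tangent_space ::
    "('a, 'e::finite_dim_normed_vector) chart set \<Rightarrow> 'a \<Rightarrow> ('a, 'e) tvec set"
  where "tangent_space A p = {v.
    (\<forall>c. \<not> (c \<in> A \<and> p \<in> cdom c) \<longrightarrow> v c = 0) \<and>
    (\<forall>c\<in>A. \<forall>d\<in>A. p \<in> cdom c \<longrightarrow> p \<in> cdom d \<longrightarrow>
      v d = frechet_derivative (coord d \<circ> chart_inv c) (at (coord c p)) (v c))}"

text \<open>The tangent vector at \<open>p\<close> whose component in the chart \<open>c\<close> is \<open>u\<close>.\<close>

definition coord_vector ::
    "('a, 'e::finite_dim_normed_vector) chart set \<Rightarrow> ('a, 'e) chart \<Rightarrow> 'e \<Rightarrow> 'a \<Rightarrow> ('a, 'e) tvec"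
  where "coord_vector A c u p = (\<lambda>d.
    if d \<in> A \<and> p \<in> cdom d then frechet_derivative (coord d \<circ> chart_inv c) (at (coord c p)) u
    else 0)"


section \<open>Tensor fields\<close>

context smooth_manifold
begin

definition vector_field :: "('a \<Rightarrow> ('a, 'e) tvec) \<Rightarrow> bool"
  where "vector_field V \<longleftrightarrow>
    (\<forall>p\<in>topspace X. V p \<in> tangent_space A p) \<and>
    (\<forall>c\<in>A. smooth_on (coord c ` cdom c) (\<lambda>x. V (chart_inv c x) c))"

definition one_form :: "('a \<Rightarrow> ('a, 'e) tvec \<Rightarrow> real) \<Rightarrow> bool"
  where "one_form \<omega> \<longleftrightarrow>
    (\<forall>p\<in>topspace X. linear_on (tangent_space A p) (\<omega> p)) \<and>
    (\<forall>c\<in>A. \<forall>u. smooth_on (coord c ` cdom c)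
      (\<lambda>x. \<omega> (chart_inv c x) (coord_vector A c u (chart_inv c x))))"

definition tensor_field_1_1 :: "('a \<Rightarrow> ('a, 'e) tvec \<Rightarrow> ('a, 'e) tvec) \<Rightarrow> bool"
  where "tensor_field_1_1 F \<longleftrightarrow>
    (\<forall>p\<in>topspace X. linear_on (tangent_space A p) (F p) \<and>
      F p ` tangent_space A p \<subseteq> tangent_space A p) \<and>
    (\<forall>c\<in>A. \<forall>u. smooth_on (coord c ` cdom c)
      (\<lambda>x. F (chart_inv c x) (coord_vector A c u (chart_inv c x)) c))"

definition tensor_field_0_2 :: "('a \<Rightarrow> ('a, 'e) tvec \<Rightarrow> ('a, 'e) tvec \<Rightarrow> real) \<Rightarrow> bool"
  where "tensor_field_0_2 b \<longleftrightarrow>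
    (\<forall>p\<in>topspace X. \<forall>v\<in>tangent_space A p.
      linear_on (tangent_space A p) (\<lambda>w. b p v w) \<and>
      linear_on (tangent_space A p) (\<lambda>w. b p w v)) \<and>
    (\<forall>c\<in>A. \<forall>u w. smooth_on (coord c ` cdom c)
      (\<lambda>x. b (chart_inv c x) (coord_vector A c u (chart_inv c x))
                             (coord_vector A c w (chart_inv c x))))"

end

definition nondegenerate_on :: "'v::real_vector set \<Rightarrow> ('v \<Rightarrow> 'v \<Rightarrow> real) \<Rightarrow> bool"
  where "nondegenerate_on V b \<longleftrightarrow> (\<forall>v\<in>V. (\<forall>w\<in>V. b v w = 0) \<longrightarrow> v = 0)"

definition form_index :: "'v::real_vector set \<Rightarrow> ('v \<Rightarrow> 'v \<Rightarrow> real) \<Rightarrow> nat"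
  where "form_index V b =
    Max {dim W | W. subspace W \<and> W \<subseteq> V \<and> (\<forall>w\<in>W. w \<noteq> 0 \<longrightarrow> b w w < 0)}"

locale semi_riemannian_manifold = smooth_manifold X A
  for X :: "'a topology" and A :: "('a, 'e::finite_dim_normed_vector) chart set" +
  fixes g :: "'a \<Rightarrow> ('a, 'e) tvec \<Rightarrow> ('a, 'e) tvec \<Rightarrow> real"
  assumes metric_tensor: "tensor_field_0_2 g"
    and metric_sym: "p \<in> topspace X \<Longrightarrow> v \<in> tangent_space A p \<Longrightarrow> w \<in> tangent_space A p \<Longrightarrow>
      g p v w = g p w v"
    and metric_nondegenerate: "p \<in> topspace X \<Longrightarrow> nondegenerate_on (tangent_space A p) (g p)"
    and constant_index: "\<exists>\<nu>. \<forall>p\<in>topspace X. form_index (tangent_space A p) (g p) = \<nu>"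


section \<open>Metric mixed 3-structures\<close>

definition \<tau> :: "nat \<Rightarrow> real"
  where "\<tau> \<alpha> = (if \<alpha> = 3 then 1 else - 1)"

definition even_perms :: "(nat \<times> nat \<times> nat) set"
  where "even_perms = {(1, 2, 3), (2, 3, 1), (3, 1, 2)}"

locale mixed_3_structure = smooth_manifold X A
  for X :: "'a topology" and A :: "('a, 'e::finite_dim_normed_vector) chart set" +
  fixes \<phi> :: "nat \<Rightarrow> 'a \<Rightarrow> ('a, 'e) tvec \<Rightarrow> ('a, 'e) tvec"
    and \<xi> :: "nat \<Rightarrow> 'a \<Rightarrow> ('a, 'e) tvec"
    and \<eta> :: "nat \<Rightarrow> 'a \<Rightarrow> ('a, 'e) tvec \<Rightarrow> real"
  assumes phi_tensor: "\<alpha> \<in> {1, 2, 3} \<Longrightarrow> tensor_field_1_1 (\<phi> \<alpha>)"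
    and xi_field: "\<alpha> \<in> {1, 2, 3} \<Longrightarrow> vector_field (\<xi> \<alpha>)"
    and eta_form: "\<alpha> \<in> {1, 2, 3} \<Longrightarrow> one_form (\<eta> \<alpha>)"
    and phi_square: "\<alpha> \<in> {1, 2, 3} \<Longrightarrow> p \<in> topspace X \<Longrightarrow> v \<in> tangent_space A p \<Longrightarrow>
      \<phi> \<alpha> p (\<phi> \<alpha> p v) = \<tau> \<alpha> *\<^sub>R (- v + \<eta> \<alpha> p v *\<^sub>R \<xi> \<alpha> p)"
    and eta_xi_same: "\<alpha> \<in> {1, 2, 3} \<Longrightarrow> p \<in> topspace X \<Longrightarrow> \<eta> \<alpha> p (\<xi> \<alpha> p) = 1"
    and eta_xi: "(\<alpha>, \<beta>, \<gamma>) \<in> even_perms \<Longrightarrow> p \<in> topspace X \<Longrightarrow>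
      \<eta> \<alpha> p (\<xi> \<beta> p) = 0 \<and> \<eta> \<beta> p (\<xi> \<alpha> p) = 0"
    and phi_xi: "(\<alpha>, \<beta>, \<gamma>) \<in> even_perms \<Longrightarrow> p \<in> topspace X \<Longrightarrow>
      \<phi> \<alpha> p (\<xi> \<beta> p) = \<tau> \<beta> *\<^sub>R \<xi> \<gamma> p \<and> \<phi> \<beta> p (\<xi> \<alpha> p) = - \<tau> \<alpha> *\<^sub>R \<xi> \<gamma> p"
    and eta_phi: "(\<alpha>, \<beta>, \<gamma>) \<in> even_perms \<Longrightarrow> p \<in> topspace X \<Longrightarrow> v \<in> tangent_space A p \<Longrightarrow>
      \<eta> \<alpha> p (\<phi> \<beta> p v) = \<tau> \<gamma> * \<eta> \<gamma> p v \<and> - \<eta> \<beta> p (\<phi> \<alpha> p v) = \<tau> \<gamma> * \<eta> \<gamma> p v"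
    and phi_phi: "(\<alpha>, \<beta>, \<gamma>) \<in> even_perms \<Longrightarrow> p \<in> topspace X \<Longrightarrow> v \<in> tangent_space A p \<Longrightarrow>
      \<phi> \<alpha> p (\<phi> \<beta> p v) - (\<tau> \<alpha> * \<eta> \<beta> p v) *\<^sub>R \<xi> \<alpha> p = \<tau> \<gamma> *\<^sub>R \<phi> \<gamma> p v \<and>
      - \<phi> \<beta> p (\<phi> \<alpha> p v) + (\<tau> \<beta> * \<eta> \<alpha> p v) *\<^sub>R \<xi> \<beta> p = \<tau> \<gamma> *\<^sub>R \<phi> \<gamma> p v"

locale metric_mixed_3_structure =
  mixed_3_structure X A \<phi> \<xi> \<eta> + semi_riemannian_manifold X A g
  for X :: "'a topology" and A :: "('a, 'e::finite_dim_normed_vector) chart set"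
    and \<phi> :: "nat \<Rightarrow> 'a \<Rightarrow> ('a, 'e) tvec \<Rightarrow> ('a, 'e) tvec"
    and \<xi> :: "nat \<Rightarrow> 'a \<Rightarrow> ('a, 'e) tvec"
    and \<eta> :: "nat \<Rightarrow> 'a \<Rightarrow> ('a, 'e) tvec \<Rightarrow> real"
    and g :: "'a \<Rightarrow> ('a, 'e) tvec \<Rightarrow> ('a, 'e) tvec \<Rightarrow> real" +
  assumes xi_unit: "\<alpha> \<in> {1, 2, 3} \<Longrightarrow> p \<in> topspace X \<Longrightarrow> g p (\<xi> \<alpha> p) (\<xi> \<alpha> p) \<in> {1, - 1}"
    and compatible_metric: "\<alpha> \<in> {1, 2, 3} \<Longrightarrow> p \<in> topspace X \<Longrightarrow>
      v \<in> tangent_space A p \<Longrightarrow> w \<in> tangent_space A p \<Longrightarrow>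
      g p (\<phi> \<alpha> p v) (\<phi> \<alpha> p w) =
        \<tau> \<alpha> * (g p v w - g p (\<xi> \<alpha> p) (\<xi> \<alpha> p) * \<eta> \<alpha> p v * \<eta> \<alpha> p w)"


section \<open>Immersed submanifolds\<close>

definition smooth_map ::
    "'b topology \<Rightarrow> ('b, 'f::finite_dim_normed_vector) chart set \<Rightarrow>
     'a topology \<Rightarrow> ('a, 'e::finite_dim_normed_vector) chart set \<Rightarrow> ('b \<Rightarrow> 'a) \<Rightarrow> bool"
  where "smooth_map Y B X A f \<longleftrightarrow> continuous_map Y X f \<and>
    (\<forall>d\<in>B. \<forall>c\<in>A. smooth_on (coord d ` (cdom d \<inter> f -` cdom c)) (coord c \<circ> f \<circ> chart_inv d))"

text \<open>By the chain rule, the differential of a smooth map at \<open>q\<close> does not depend on the chart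
  that is chosen around \<open>q\<close>.\<close>

definition differential ::
    "('b, 'f::finite_dim_normed_vector) chart set \<Rightarrow>
     ('a, 'e::finite_dim_normed_vector) chart set \<Rightarrow>
     ('b \<Rightarrow> 'a) \<Rightarrow> 'b \<Rightarrow> ('b, 'f) tvec \<Rightarrow> ('a, 'e) tvec"
  where "differential B A f q v =
    (let d = (SOME d. d \<in> B \<and> q \<in> cdom d) in
      (\<lambda>c. if c \<in> A \<and> f q \<in> cdom c
        then frechet_derivative (coord c \<circ> f \<circ> chart_inv d) (at (coord d q)) (v d)
        else 0))"

locale immersed_submanifold =
  ambient: smooth_manifold X A + sub: smooth_manifold Y B
  for X :: "'a topology" and A :: "('a, 'e::finite_dim_normed_vector) chart set"
    and Y :: "'b topology" and B :: "('b, 'f::finite_dim_normed_vector) chart set" +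
  fixes f :: "'b \<Rightarrow> 'a"
  assumes smooth_immersion: "smooth_map Y B X A f"
    and immersion: "q \<in> topspace Y \<Longrightarrow> inj_on (differential B A f q) (tangent_space B q)"

text \<open>The tangent space of the submanifold at \<open>q\<close>, as a subspace of the ambient tangent space
  at \<open>f q\<close>, and its orthogonal complement there.\<close>

definition sub_tangent ::
    "('a, 'e::finite_dim_normed_vector) chart set \<Rightarrow>
     ('b, 'f::finite_dim_normed_vector) chart set \<Rightarrow> ('b \<Rightarrow> 'a) \<Rightarrow> 'b \<Rightarrow> ('a, 'e) tvec set"
  where "sub_tangent A B f q = differential B A f q ` tangent_space B q"

definition sub_normal ::
    "('a, 'e::finite_dim_normed_vector) chart set \<Rightarrow>
     ('a \<Rightarrow> ('a, 'e) tvec \<Rightarrow> ('a, 'e) tvec \<Rightarrow> real) \<Rightarrow>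
     ('b, 'f::finite_dim_normed_vector) chart set \<Rightarrow> ('b \<Rightarrow> 'a) \<Rightarrow> 'b \<Rightarrow> ('a, 'e) tvec set"
  where "sub_normal A g B f q =
    {w \<in> tangent_space A (f q). \<forall>v\<in>sub_tangent A B f q. g (f q) w v = 0}"

definition nondegenerate_submanifold ::
    "('a, 'e::finite_dim_normed_vector) chart set \<Rightarrow>
     ('a \<Rightarrow> ('a, 'e) tvec \<Rightarrow> ('a, 'e) tvec \<Rightarrow> real) \<Rightarrow>
     'b topology \<Rightarrow> ('b, 'f::finite_dim_normed_vector) chart set \<Rightarrow> ('b \<Rightarrow> 'a) \<Rightarrow> bool"
  where "nondegenerate_submanifold A g Y B f \<longleftrightarrow>
    (\<forall>q\<in>topspace Y. nondegenerate_on (sub_tangent A B f q) (g (f q)))"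

definition invariant_submanifold ::
    "('a, 'e::finite_dim_normed_vector) chart set \<Rightarrow>
     (nat \<Rightarrow> 'a \<Rightarrow> ('a, 'e) tvec \<Rightarrow> ('a, 'e) tvec) \<Rightarrow>
     'b topology \<Rightarrow> ('b, 'f::finite_dim_normed_vector) chart set \<Rightarrow> ('b \<Rightarrow> 'a) \<Rightarrow> bool"
  where "invariant_submanifold A \<phi> Y B f \<longleftrightarrow>
    (\<forall>q\<in>topspace Y. \<forall>\<alpha>\<in>{1, 2, 3}. \<phi> \<alpha> (f q) ` sub_tangent A B f q \<subseteq> sub_tangent A B f q)"

definition tangent_to ::
    "('a, 'e::finite_dim_normed_vector) chart set \<Rightarrow> 'b topology \<Rightarrow>
     ('b, 'f::finite_dim_normed_vector) chart set \<Rightarrow> ('b \<Rightarrow> 'a) \<Rightarrow> ('a \<Rightarrow> ('a, 'e) tvec) \<Rightarrow> bool"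
  where "tangent_to A Y B f V \<longleftrightarrow> (\<forall>q\<in>topspace Y. V (f q) \<in> sub_tangent A B f q)"

definition normal_to ::
    "('a, 'e::finite_dim_normed_vector) chart set \<Rightarrow>
     ('a \<Rightarrow> ('a, 'e) tvec \<Rightarrow> ('a, 'e) tvec \<Rightarrow> real) \<Rightarrow> 'b topology \<Rightarrow>
     ('b, 'f::finite_dim_normed_vector) chart set \<Rightarrow> ('b \<Rightarrow> 'a) \<Rightarrow> ('a \<Rightarrow> ('a, 'e) tvec) \<Rightarrow> bool"
  where "normal_to A g Y B f V \<longleftrightarrow> (\<forall>q\<in>topspace Y. V (f q) \<in> sub_normal A g B f q)"

end

theory Submission
  imports Defs
begin

text \<open>
  Let \<open>V\<close> be the tangent space of the submanifold at a point. For \<open>v \<in> V\<close>, invariance and the formula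
  for the square of \<open>\<phi> \<alpha>\<close> give \<open>\<eta> \<alpha> v *\<^sub>R \<xi> \<alpha> \<in> V\<close>. So either some \<open>\<xi> \<alpha>\<close> lies in \<open>V\<close>, and then all
  three do because the \<open>\<phi> \<beta>\<close> permute them up to sign, or all \<open>\<eta> \<alpha>\<close> vanish on \<open>V\<close>, which means that all
  \<open>\<xi> \<alpha>\<close> are normal. As the submanifold may be disconnected, it remains to exclude that different
  points behave differently. On \<open>V\<close> the map \<open>\<phi> 3\<close> is a complex structure in the normal case, and a
  complex structure modulo the line spanned by \<open>\<xi> 3\<close> in the tangent case, so \<open>dim V\<close> is even in the
  normal and odd in the tangent case; but \<open>dim V\<close> is the same at all points.
\<close>

section \<open>Linear algebra: complex structures modulo a subspace\<close>

lemma linear_onD: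
  assumes "linear_on V f"
  shows "v \<in> V \<Longrightarrow> w \<in> V \<Longrightarrow> f (v + w) = f v + f w"
    and "v \<in> V \<Longrightarrow> f (r *\<^sub>R v) = r *\<^sub>R f v"
    and "v \<in> V \<Longrightarrow> f 0 = 0"
    using assms unfolding linear_on_def by (blast, blast, metis scaleR_zero_left)

lemma linear_on_image_span_subset:
  assumes V: "subspace V" and J: "linear_on V J" and S: "S \<subseteq> V" "J ` S \<subseteq> span S'"
  shows "J ` span S \<subseteq> span S'"
proof -
  \<comment> \<open>Since \<open>J\<close> is linear only on \<open>V\<close>, the induction has to
    carry membership in \<open>V\<close> along.\<close>
  have "v \<in> V \<and> J v \<in> span S'" if "v \<in> span S" for v
    using that
  proof (induction rule: span_induct_alt)
    case base
    show ?case
      using linear_onD(3)[OF J subspace_0[OF V]] V by (simp add: subspace_0 span_zero)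
  next
    case (step c x y)
    have x: "x \<in> V" "J x \<in> span S'" and cx: "c *\<^sub>R x \<in> V"
      using step S V by (auto simp: subspace_scale)
    have "J (c *\<^sub>R x + y) = c *\<^sub>R J x + J y"
      using linear_onD(1)[OF J cx] linear_onD(2)[OF J x(1)] step by simp
    with x cx step V show ?case
      by (simp add: subspace_add span_add span_scale)
  qed
  then show ?thesis by blast
qed

text \<open>On the quotient of \<open>V\<close> by \<open>span S\<close> the map \<open>J\<close>
  squares to minus the identity, so that quotient has even dimension. The quotient is never formed:
  \<open>S\<close> grows by pairs until it is a basis of \<open>V\<close>. The set \<open>C\<close>
  keeps \<open>V\<close> finite-dimensional inside a vector space that need not be.\<close>

lemma even_dim_add_card_of_complex_structure_mod_span:
  fixes J :: "'v::real_vector \<Rightarrow> 'v"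
  assumes V: "subspace V" and J: "linear_on V J" "J ` V \<subseteq> V"
    and C: "finite C" "V \<subseteq> span C"
    and S: "S \<subseteq> V" "independent S" "J ` S \<subseteq> span S"
    and square: "\<And>v. v \<in> V \<Longrightarrow> J (J v) + v \<in> span S"
  shows "even (dim V + card S)"
  using S square
proof (induction "card C - card S" arbitrary: S rule: less_induct)
  case less
  have fin: "finite S"
    using independent_span_bound[OF C(1) less.prems(2)] less.prems(1) C(2) by blast
  have JS: "J ` span S \<subseteq> span S"
    by (rule linear_on_image_span_subset[OF V J(1) less.prems(1,3)])
  show ?case
  proof (cases "V \<subseteq> span S")
    case True
    then have "card S = dim V"
      using basis_card_eq_dim less.prems by blast
    then show ?thesis by simp
  next
    case False
    then obtain v where v: "v \<in> V" "v \<notin> span S" by blast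
    \<comment> \<open>If \<open>J v = s + a *\<^sub>R v\<close> with \<open>s \<in> span S\<close>, applying \<open>J\<close> puts \<open>(1 + a\<^sup>2) *\<^sub>R v\<close> into \<open>span S\<close>. Hence an
      independent set that spans a \<open>J\<close>-invariant subspace can be enlarged by two vectors at a time.\<close>
    have Jv: "J v \<notin> span (insert v S)"
    proof
      assume "J v \<in> span (insert v S)"
      then obtain a where a: "J v - a *\<^sub>R v \<in> span S"
        by (auto simp: span_insert)
      define s where "s = J v - a *\<^sub>R v"
      have s: "s \<in> span S" "s \<in> V" "J v = s + a *\<^sub>R v"
        using a span_minimal[OF less.prems(1) V] unfolding s_def by auto
      have "J (J v) = J s + a *\<^sub>R J v"
        using s linear_onD(1)[OF J(1) s(2)] linear_onD(2)[OF J(1) v(1)] V v(1)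
        by (simp add: subspace_scale)
      then have "J (J v) + v = (J s + a *\<^sub>R s) + (1 + a * a) *\<^sub>R v"
        using s(3) by (simp add: algebra_simps)
      moreover have "J s + a *\<^sub>R s \<in> span S"
        using JS s(1) by (simp add: span_add span_scale image_subset_iff)
      ultimately have "(1 + a * a) *\<^sub>R v \<in> span S"
        using less.prems(4)[OF v(1)] span_add_eq by metis
      then have "(1 / (1 + a * a)) *\<^sub>R (1 + a * a) *\<^sub>R v \<in> span S"
        by (rule span_scale)
      moreover have "1 + a * a \<noteq> 0"
        by (smt (verit) zero_le_square)
      ultimately show False
        using v(2) by simp
    qed
    let ?S = "insert (J v) (insert v S)"
    have sub: "?S \<subseteq> V" using less.prems(1) v(1) J(2) by blast
    have indep: "independent ?S"
      using less.prems(2) v(2) Jv by (metis independent_insertI)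
    have mono: "span S \<subseteq> span ?S" by (rule span_mono) blast
    have "J (J v) \<in> span ?S"
    proof -
      have "J (J v) + v \<in> span ?S" "v \<in> span ?S"
        using less.prems(4)[OF v(1)] mono by (auto intro: span_base)
      then show ?thesis using span_diff by fastforce
    qed
    then have inv: "J ` ?S \<subseteq> span ?S"
      using less.prems(3) mono by (auto intro: span_base)
    have card: "card ?S = card S + 2"
    proof -
      have "v \<notin> S" "J v \<notin> insert v S" using v(2) Jv span_base by blast+
      then show ?thesis using fin by simp
    qed
    \<comment> \<open>This bound makes the truncated difference in the induction measure really
      drop.\<close>
    have "card ?S \<le> card C"
      using independent_span_bound[OF C(1) indep] sub C(2) by blast
    then have "card C - card ?S < card C - card S"
      using card by simp
    then have "even (dim V + card ?S)"
      using less.hyps[OF _ sub indep inv] less.prems(4) mono by blast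
    then show ?thesis by (simp add: card)
  qed
qed

section \<open>Charts, the chain rule and tangent vectors\<close>

context smooth_manifold
begin

lemma cdom_subset_topspace: "c \<in> A \<Longrightarrow> cdom c \<subseteq> topspace X"
  using charts openin_subset unfolding is_chart_def by blast

lemma obtain_chart:
  assumes "p \<in> topspace X"
  obtains c where "c \<in> A" "p \<in> cdom c"
  using assms covering by blast

lemma chart_inv_coord [simp]:
  assumes "c \<in> A" "p \<in> cdom c"
  shows "chart_inv c (coord c p) = p"
proof -
  have "inj_on (coord c) (topspace (subtopology X (cdom c)))"
    using charts[OF assms(1)] homeomorphic_imp_injective_map unfolding is_chart_def by blast
  then have "inj_on (coord c) (cdom c)"
    using cdom_subset_topspace[OF assms(1)] by (simp add: inf.absorb2)
  then show ?thesis
    using assms(2) by (simp add: chart_inv_def)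
qed

lemma open_coord_image:
  assumes "c \<in> A" "openin X U" "U \<subseteq> cdom c"
  shows "open (coord c ` U)"
proof -
  have c: "open (coord c ` cdom c)"
    "open_map (subtopology X (cdom c)) (top_of_set (coord c ` cdom c)) (coord c)"
    using charts[OF assms(1)] homeomorphic_imp_open_map unfolding is_chart_def by blast+
  have "openin (subtopology X (cdom c)) U"
    using assms(2,3) openin_subtopology_Int[OF assms(2), of "cdom c"] by (simp add: inf.absorb1)
  then have "openin (top_of_set (coord c ` cdom c)) (coord c ` U)"
    using c(2) unfolding open_map_def by blast
  then show ?thesis
    using c(1) openin_open_eq by blast
qed

text \<open>Coordinate changes become coordinate expressions of a smooth map, so one chain rule
  serves both them and the immersion.\<close>

lemma smooth_map_id: "smooth_map X A X A id"
  using compatible by (simp add: smooth_map_def)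

end

lemma smooth_on_differentiable:
  assumes "smooth_on S f" "x \<in> S"
  shows "f differentiable (at x)"
proof -
  have "C_k_on (Suc 0) S f" using assms(1) unfolding smooth_on_def by blast
  with assms(2) show ?thesis by simp
qed

lemma smooth_map_differentiable:
  assumes "smooth_map Y B X A f" "d \<in> B" "c \<in> A" "q \<in> cdom d" "f q \<in> cdom c"
  shows "(coord c \<circ> f \<circ> chart_inv d) differentiable (at (coord d q))"
  using assms unfolding smooth_map_def by (intro smooth_on_differentiable) auto

text \<open>This is the compatibility between charts that \<open>tangent_space\<close> demands. With
  \<open>f = id\<close> it applies to coordinate vectors, with the immersion to images under its
  differential.\<close>

lemma smooth_map_chain_rule:
  assumes "smooth_manifold X A" "smooth_manifold Y B" and f: "smooth_map Y B X A f"
    and d: "d \<in> B" "q \<in> cdom d" and c: "c \<in> A" "f q \<in> cdom c" and e: "e \<in> A" "f q \<in> cdom e"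
  shows "frechet_derivative (coord e \<circ> f \<circ> chart_inv d) (at (coord d q)) u =
    frechet_derivative (coord e \<circ> chart_inv c) (at (coord c (f q)))
      (frechet_derivative (coord c \<circ> f \<circ> chart_inv d) (at (coord d q)) u)"
proof -
  interpret X: smooth_manifold X A by fact
  interpret Y: smooth_manifold Y B by fact
  let ?F = "coord c \<circ> f \<circ> chart_inv d" and ?G = "coord e \<circ> chart_inv c"
  \<comment> \<open>The two coordinate expressions of \<open>f\<close> need to agree only where
    \<open>f\<close> stays in \<open>cdom c\<close>. As \<open>?U\<close> has open image under
    \<open>coord d\<close>, this suffices for the derivatives.\<close>
  let ?U = "cdom d \<inter> {y \<in> topspace Y. f y \<in> cdom c}"
  have "openin Y {y \<in> topspace Y. f y \<in> cdom c}"
    using f X.charts[OF c(1)] unfolding smooth_map_def is_chart_def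
    by (blast intro: openin_continuous_map_preimage)
  then have "openin Y ?U"
    using Y.charts[OF d(1)] unfolding is_chart_def by blast
  then have op: "open (coord d ` ?U)"
    using Y.open_coord_image[OF d(1)] by blast
  have q: "coord d q \<in> coord d ` ?U"
    using d c Y.cdom_subset_topspace by blast
  have Fq: "?F (coord d q) = coord c (f q)"
    using Y.chart_inv_coord[OF d] by simp
  have "?F differentiable (at (coord d q))"
    by (rule smooth_map_differentiable[OF f d(1) c(1) d(2) c(2)])
  moreover have "?G differentiable (at (?F (coord d q)))"
    using smooth_map_differentiable[OF X.smooth_map_id c(1) e(1) c(2)] e(2) Fq by simp
  ultimately have comp: "(?G \<circ> ?F has_derivative frechet_derivative ?G (at (?F (coord d q))) \<circ>
      frechet_derivative ?F (at (coord d q))) (at (coord d q))"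
    by (intro diff_chain_at) (simp_all only: frechet_derivative_works)
  have "(?G \<circ> ?F) x = (coord e \<circ> f \<circ> chart_inv d) x" if "x \<in> coord d ` ?U" for x
    using that X.chart_inv_coord[OF c(1)] Y.chart_inv_coord[OF d(1)] by auto
  from comp op q this have "(coord e \<circ> f \<circ> chart_inv d has_derivative
      frechet_derivative ?G (at (?F (coord d q))) \<circ> frechet_derivative ?F (at (coord d q)))
      (at (coord d q))"
    by (rule has_derivative_transform_within_open)
  from frechet_derivative_at[OF this, symmetric] show ?thesis
    by (simp add: Y.chart_inv_coord[OF d])
qed

context smooth_manifold
begin

lemma coord_vector_in_tangent_space:
  assumes "c \<in> A" "p \<in> cdom c"
  shows "coord_vector A c u p \<in> tangent_space A p"
proof -
  let ?v = "coord_vector A c u p"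
  have "?v e = frechet_derivative (coord e \<circ> chart_inv d) (at (coord d p)) (?v d)"
    if "d \<in> A" "e \<in> A" "p \<in> cdom d" "p \<in> cdom e" for d e
    using smooth_map_chain_rule[OF smooth_manifold_axioms smooth_manifold_axioms smooth_map_id
        assms, of d e u] that
    by (simp only: coord_vector_def id_apply comp_id simp_thms if_True)
  moreover have "?v d = 0" if "\<not> (d \<in> A \<and> p \<in> cdom d)" for d
    using that by (auto simp: coord_vector_def)
  ultimately show ?thesis
    unfolding tangent_space_def by blast
qed

lemma coord_vector_same:
  assumes "c \<in> A" "p \<in> cdom c"
  shows "coord_vector A c u p c = u"
proof -
  have "open (coord c ` cdom c)"
    using charts[OF assms(1)] unfolding is_chart_def by blast
  moreover have "id x = (coord c \<circ> chart_inv c) x" if "x \<in> coord c ` cdom c" for x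
    using that assms(1) by auto
  ultimately have "(coord c \<circ> chart_inv c has_derivative id) (at (coord c p))"
    using assms(2) by (intro has_derivative_transform_within_open[OF has_derivative_id]) blast+
  from frechet_derivative_at[OF this, symmetric] show ?thesis
    using assms by (simp add: coord_vector_def)
qed

lemma tangent_space_component_surj:
  assumes "c \<in> A" "p \<in> cdom c"
  shows "(\<lambda>v. v c) ` tangent_space A p = UNIV"
  using coord_vector_in_tangent_space[OF assms] coord_vector_same[OF assms]
  by (metis (mono_tags, lifting) UNIV_eq_I image_eqI)

end

section \<open>Tangent spaces of the submanifold as images of its model space\<close>

context immersed_submanifold
begin

text \<open>The differential depends only on the component in one chart, and that component ranges
  over the whole model space. So at every point the tangent space is an injective linear image of
  the same space \<open>'f\<close>, which fixes its dimension.\<close>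

lemma sub_tangent_eq_range_linear_inj:
  assumes q: "q \<in> topspace Y"
  obtains L :: "'f \<Rightarrow> ('a, 'e) tvec" where "linear L" "inj L" "sub_tangent A B f q = range L"
    "range L \<subseteq> tangent_space A (f q)"
proof -
  \<comment> \<open>The same choice as in \<open>differential\<close>, so that the differential
    unfolds to \<open>L\<close> applied to the component at \<open>d\<close>.\<close>
  define d where "d = (SOME d. d \<in> B \<and> q \<in> cdom d)"
  have d: "d \<in> B" "q \<in> cdom d"
    using someI_ex[of "\<lambda>d. d \<in> B \<and> q \<in> cdom d"] sub.obtain_chart[OF q] unfolding d_def by blast+
  define L where "L u = (\<lambda>c. if c \<in> A \<and> f q \<in> cdom c
    then frechet_derivative (coord c \<circ> f \<circ> chart_inv d) (at (coord d q)) u else 0)" for u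
  have diff: "differential B A f q v = L (v d)" for v
    by (simp add: differential_def L_def Let_def flip: d_def)
  note onto = sub.tangent_space_component_surj[OF d]
  have image: "sub_tangent A B f q = range L"
    unfolding sub_tangent_def onto[symmetric] by (simp add: diff image_image)
  have lin: "linear (frechet_derivative (coord c \<circ> f \<circ> chart_inv d) (at (coord d q)))"
    if "c \<in> A" "f q \<in> cdom c" for c
    using smooth_map_differentiable[OF smooth_immersion d(1) that(1) d(2) that(2)]
    by (rule linear_frechet_derivative)
  have linear: "linear L"
  proof (rule linearI)
    show "L (u + w) = L u + L w" for u w
      by (rule ext) (simp add: L_def plus_fun_def linear_add[OF lin])
    show "L (r *\<^sub>R u) = r *\<^sub>R L u" for r u
      by (rule ext) (simp add: L_def scaleR_fun_def linear_scale[OF lin])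
  qed
  have inj: "inj L"
  proof (rule injI)
    fix u w assume eq: "L u = L w"
    have "u \<in> (\<lambda>v. v d) ` tangent_space B q" "w \<in> (\<lambda>v. v d) ` tangent_space B q"
      unfolding onto by simp_all
    then obtain v v' where
      v: "v \<in> tangent_space B q" "v d = u" "v' \<in> tangent_space B q" "v' d = w"
      by blast
    then show "u = w"
      using inj_onD[OF immersion[OF q], of v v'] eq by (auto simp: diff)
  qed
  have range: "range L \<subseteq> tangent_space A (f q)"
  proof (rule image_subsetI)
    fix u
    have "L u e = frechet_derivative (coord e \<circ> chart_inv c) (at (coord c (f q))) (L u c)"
      if "c \<in> A" "e \<in> A" "f q \<in> cdom c" "f q \<in> cdom e" for c e
      using smooth_map_chain_rule[OF ambient.smooth_manifold_axioms sub.smooth_manifold_axioms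
          smooth_immersion d that(1,3,2,4), of u] that
      by (simp only: L_def simp_thms if_True)
    moreover have "L u c = 0" if "\<not> (c \<in> A \<and> f q \<in> cdom c)" for c
      using that by (auto simp: L_def)
    ultimately show "L u \<in> tangent_space A (f q)"
      unfolding tangent_space_def by blast
  qed
  show ?thesis
    using linear inj image range by (rule that)
qed

end

lemma finite_spanning_set:
  obtains C :: "'f::finite_dim_normed_vector set" where "finite C" "span C = UNIV"
proof -
  obtain C :: "'f set" where C: "finite C" "\<forall>x. \<exists>r. x = (\<Sum>b\<in>C. r b *\<^sub>R b)"
    using finite_dim by blast
  have "x \<in> span C" for x
  proof -
    obtain r where "x = (\<Sum>b\<in>C. r b *\<^sub>R b)" using C(2) by blast
    then show ?thesis by (simp add: span_sum span_scale span_base)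
  qed
  then show ?thesis using that C(1) by blast
qed

lemma dim_range_linear_inj:
  fixes L :: "'u::real_vector \<Rightarrow> 'v::real_vector"
  assumes "linear L" "inj L"
  shows "dim (range L) = dim (UNIV :: 'u set)"
proof -
  obtain C :: "'u set" where C: "C \<subseteq> UNIV" "independent C" "UNIV \<subseteq> span C"
    "card C = dim (UNIV :: 'u set)"
    using basis_exists[of UNIV] .
  show ?thesis
  proof (rule dim_unique)
    show "range L \<subseteq> span (L ` C)"
      using C(3) linear_span_image[OF assms(1), of C] by auto
    show "independent (L ` C)"
      using linear_independent_injective_image[OF assms(1) C(2)] assms(2) inj_on_subset by blast
    show "card (L ` C) = dim (UNIV :: 'u set)"
      using C(4) assms(2) by (simp add: card_image inj_on_subset)
  qed blast
qed

section \<open>Pointwise algebra of the mixed 3-structure\<close>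

context metric_mixed_3_structure
begin

lemma xi_in_tangent_space: "\<alpha> \<in> {1, 2, 3} \<Longrightarrow> p \<in> topspace X \<Longrightarrow> \<xi> \<alpha> p \<in> tangent_space A p"
  using xi_field unfolding vector_field_def by blast

lemma phi_linear:
  assumes "\<alpha> \<in> {1, 2, 3}" "p \<in> topspace X"
  shows "linear_on (tangent_space A p) (\<phi> \<alpha> p)"
    and "v \<in> tangent_space A p \<Longrightarrow> \<phi> \<alpha> p v \<in> tangent_space A p"
  using phi_tensor[OF assms(1)] assms(2) unfolding tensor_field_1_1_def by blast+

lemma phi_xi_same:
  assumes \<alpha>: "\<alpha> \<in> {1, 2, 3}" and p: "p \<in> topspace X"
  shows "\<phi> \<alpha> p (\<xi> \<alpha> p) = 0"
proof -
  \<comment> \<open>The square of \<open>\<phi> \<alpha>\<close> kills \<open>\<xi> \<alpha>\<close>, hence also \<open>w\<close>; so \<open>w\<close> is a multiple of \<open>\<xi> \<alpha>\<close>, and \<open>\<phi> \<alpha> w = 0\<close>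
    forces the factor to vanish unless \<open>w = 0\<close>.\<close>
  define w where "w = \<phi> \<alpha> p (\<xi> \<alpha> p)"
  note \<xi> = xi_in_tangent_space[OF \<alpha> p] and lin = linear_onD[OF phi_linear(1)[OF \<alpha> p]]
  have w: "w \<in> tangent_space A p"
    using phi_linear(2)[OF \<alpha> p \<xi>] by (simp add: w_def)
  have \<phi>w: "\<phi> \<alpha> p w = 0"
    using phi_square[OF \<alpha> p \<xi>] eta_xi_same[OF \<alpha> p] by (simp add: w_def)
  then have "\<tau> \<alpha> *\<^sub>R (- w + \<eta> \<alpha> p w *\<^sub>R \<xi> \<alpha> p) = 0"
    using phi_square[OF \<alpha> p w] lin(3)[OF w] by simp
  then have weq: "w = \<eta> \<alpha> p w *\<^sub>R \<xi> \<alpha> p"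
    by (simp add: \<tau>_def split: if_splits)
  then have "\<eta> \<alpha> p w *\<^sub>R w = 0"
    using lin(2)[OF \<xi>, of "\<eta> \<alpha> p w"] \<phi>w by (simp add: w_def)
  with weq show ?thesis
    unfolding w_def[symmetric] by (metis scaleR_eq_0_iff)
qed

text \<open>Put \<open>\<xi> \<alpha>\<close> into the second slot of the metric compatibility: the
  left side vanishes because \<open>\<phi> \<alpha>\<close> kills \<open>\<xi> \<alpha>\<close>.
  This turns vanishing of \<open>\<eta> \<alpha>\<close> on a subspace into orthogonality to
  \<open>\<xi> \<alpha>\<close>.\<close>

lemma eta_eq_metric_xi:
  assumes \<alpha>: "\<alpha> \<in> {1, 2, 3}" and p: "p \<in> topspace X" and v: "v \<in> tangent_space A p"
  shows "g p (\<xi> \<alpha> p) v = g p (\<xi> \<alpha> p) (\<xi> \<alpha> p) * \<eta> \<alpha> p v"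
proof -
  note \<xi> = xi_in_tangent_space[OF \<alpha> p] and \<phi>v = phi_linear(2)[OF \<alpha> p v]
  have "linear_on (tangent_space A p) (\<lambda>w. g p (\<phi> \<alpha> p v) w)"
    using metric_tensor p \<phi>v unfolding tensor_field_0_2_def by blast
  then have "g p (\<phi> \<alpha> p v) 0 = 0"
    using linear_onD(3) v by blast
  then have "\<tau> \<alpha> * (g p v (\<xi> \<alpha> p) - g p (\<xi> \<alpha> p) (\<xi> \<alpha> p) * \<eta> \<alpha> p v) = 0"
    using compatible_metric[OF \<alpha> p v \<xi>] by (simp add: phi_xi_same[OF \<alpha> p] eta_xi_same[OF \<alpha> p])
  then show ?thesis
    using metric_sym[OF p v \<xi>] by (simp add: \<tau>_def split: if_splits)
qed

lemma xi_nonzero: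
  assumes "\<alpha> \<in> {1, 2, 3}" "p \<in> topspace X"
  shows "\<xi> \<alpha> p \<noteq> 0"
proof
  assume "\<xi> \<alpha> p = 0"
  moreover have "linear_on (tangent_space A p) (\<eta> \<alpha> p)"
    using eta_form[OF assms(1)] assms(2) unfolding one_form_def by blast
  ultimately show False
    using eta_xi_same[OF assms] linear_onD(3) xi_in_tangent_space[OF assms] by fastforce
qed

lemma invariant_subspace_all_xi:
  assumes p: "p \<in> topspace X" and V: "subspace V"
    and inv: "\<And>\<alpha> v. \<alpha> \<in> {1, 2, 3} \<Longrightarrow> v \<in> V \<Longrightarrow> \<phi> \<alpha> p v \<in> V"
    and \<alpha>: "\<alpha> \<in> {1, 2, 3}" "\<xi> \<alpha> p \<in> V" and \<beta>: "\<beta> \<in> {1, 2, 3}"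
  shows "\<xi> \<beta> p \<in> V"
proof -
  have step: "\<xi> b p \<in> V \<and> \<xi> c p \<in> V" if abc: "(a, b, c) \<in> even_perms" and a: "\<xi> a p \<in> V" for a b c
  proof -
    \<comment> \<open>The triple \<open>(a, b, c)\<close> gives the image of \<open>\<xi> a\<close>
      under \<open>\<phi> b\<close>, a multiple of \<open>\<xi> c\<close>; the shifted triple gives
      its image under \<open>\<phi> c\<close>, a multiple of \<open>\<xi> b\<close>.\<close>
    have cab: "(c, a, b) \<in> even_perms" and mem: "b \<in> {1, 2, 3}" "c \<in> {1, 2, 3}"
      using abc by (auto simp: even_perms_def)
    have "- \<tau> a *\<^sub>R \<xi> c p \<in> V" "\<tau> a *\<^sub>R \<xi> b p \<in> V"
      using phi_xi[OF abc p] phi_xi[OF cab p] inv[OF mem(1) a] inv[OF mem(2) a] by auto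
    then show ?thesis
      using subspace_neg[OF V] by (fastforce simp: \<tau>_def split: if_splits)
  qed
  have "\<forall>\<beta>\<in>{1, 2, 3}. \<xi> \<beta> p \<in> V"
    using \<alpha>(1)
  proof (elim insertE emptyE)
    assume "\<alpha> = 1"
    with step[of 1 2 3] \<alpha>(2) show ?thesis by (simp add: even_perms_def)
  next
    assume "\<alpha> = 2"
    with step[of 2 3 1] \<alpha>(2) show ?thesis by (simp add: even_perms_def)
  next
    assume "\<alpha> = 3"
    with step[of 3 1 2] \<alpha>(2) show ?thesis by (simp add: even_perms_def)
  qed
  with \<beta> show ?thesis by blast
qed

lemma invariant_subspace_xi_or_eta:
  assumes p: "p \<in> topspace X" and V: "subspace V" "V \<subseteq> tangent_space A p"
    and inv: "\<And>\<alpha> v. \<alpha> \<in> {1, 2, 3} \<Longrightarrow> v \<in> V \<Longrightarrow> \<phi> \<alpha> p v \<in> V"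
  shows "(\<forall>\<alpha>\<in>{1, 2, 3}. \<xi> \<alpha> p \<in> V) \<or> (\<forall>\<alpha>\<in>{1, 2, 3}. \<forall>v\<in>V. \<eta> \<alpha> p v = 0)"
proof (rule disjCI)
  assume "\<not> (\<forall>\<alpha>\<in>{1, 2, 3}. \<forall>v\<in>V. \<eta> \<alpha> p v = 0)"
  then obtain \<alpha> v where \<alpha>: "\<alpha> \<in> {1, 2, 3}" and v: "v \<in> V" "\<eta> \<alpha> p v \<noteq> 0" by blast
  have "\<tau> \<alpha> *\<^sub>R (- v + \<eta> \<alpha> p v *\<^sub>R \<xi> \<alpha> p) \<in> V"
    using phi_square[OF \<alpha> p] inv[OF \<alpha> inv[OF \<alpha> v(1)]] V(2) v(1) by auto
  then have "(1 / \<tau> \<alpha>) *\<^sub>R \<tau> \<alpha> *\<^sub>R (- v + \<eta> \<alpha> p v *\<^sub>R \<xi> \<alpha> p) \<in> V"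
    by (rule subspace_scale[OF V(1)])
  then have "- v + \<eta> \<alpha> p v *\<^sub>R \<xi> \<alpha> p \<in> V"
    by (simp add: \<tau>_def split: if_splits)
  then have "\<eta> \<alpha> p v *\<^sub>R \<xi> \<alpha> p \<in> V"
    using subspace_add[OF V(1) v(1)] by fastforce
  then have "(1 / \<eta> \<alpha> p v) *\<^sub>R \<eta> \<alpha> p v *\<^sub>R \<xi> \<alpha> p \<in> V"
    by (rule subspace_scale[OF V(1)])
  then have "\<xi> \<alpha> p \<in> V"
    using v(2) by simp
  then show "\<forall>\<beta>\<in>{1, 2, 3}. \<xi> \<beta> p \<in> V"
    using invariant_subspace_all_xi[OF p V(1) inv \<alpha>] by blast
qed

text \<open>The index 3 matters: \<open>\<tau> 3 = 1\<close> makes \<open>\<phi> 3\<close> square to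
  minus the identity up to multiples of \<open>\<xi> 3\<close>. For the indices 1 and 2 the square
  is plus the identity up to such multiples, which says nothing about parity.\<close>

lemma invariant_subspace_parity:
  assumes p: "p \<in> topspace X" and V: "subspace V" "V \<subseteq> tangent_space A p"
    and C: "finite C" "V \<subseteq> span C"
    and inv: "\<And>v. v \<in> V \<Longrightarrow> \<phi> 3 p v \<in> V"
  shows "\<xi> 3 p \<in> V \<Longrightarrow> odd (dim V)"
    and "(\<And>v. v \<in> V \<Longrightarrow> \<eta> 3 p v = 0) \<Longrightarrow> even (dim V)"
proof -
  have lin: "linear_on V (\<phi> 3 p)"
    using phi_linear(1)[of 3 p] p V(2) unfolding linear_on_def by blast
  have inv': "\<phi> 3 p ` V \<subseteq> V" using inv by blast
  have square: "\<phi> 3 p (\<phi> 3 p v) + v = \<eta> 3 p v *\<^sub>R \<xi> 3 p" if "v \<in> V" for v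
    using phi_square[of 3 p v] p V(2) that by (auto simp: \<tau>_def)
  note parity = even_dim_add_card_of_complex_structure_mod_span[OF V(1) lin inv' C]
  \<comment> \<open>Here \<open>S\<close> has one element: \<open>\<xi> 3 p\<close> is nonzero,
    hence independent, and \<open>\<phi> 3\<close> sends it to 0.\<close>
  show "odd (dim V)" if "\<xi> 3 p \<in> V"
    using parity[of "{\<xi> 3 p}"] that xi_nonzero[of 3 p] p phi_xi_same[of 3 p]
    by (simp add: square span_zero span_base span_scale)
  \<comment> \<open>With \<open>\<eta> 3\<close> zero on \<open>V\<close> the error term disappears,
    so \<open>S\<close> can be empty.\<close>
  show "even (dim V)" if "\<And>v. v \<in> V \<Longrightarrow> \<eta> 3 p v = 0"
    using parity[of "{}"] that by (simp add: square independent_empty)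
qed

end

section \<open>From single points to the whole submanifold\<close>

theorem proposition3p8:
  fixes X :: "'a topology" and A :: "('a, 'e::finite_dim_normed_vector) chart set"
    and \<phi> :: "nat \<Rightarrow> 'a \<Rightarrow> ('a, 'e) tvec \<Rightarrow> ('a, 'e) tvec"
    and \<xi> :: "nat \<Rightarrow> 'a \<Rightarrow> ('a, 'e) tvec"
    and \<eta> :: "nat \<Rightarrow> 'a \<Rightarrow> ('a, 'e) tvec \<Rightarrow> real"
    and g :: "'a \<Rightarrow> ('a, 'e) tvec \<Rightarrow> ('a, 'e) tvec \<Rightarrow> real"
    and Y :: "'b topology" and B :: "('b, 'f::finite_dim_normed_vector) chart set"
    and f :: "'b \<Rightarrow> 'a"
  assumes "metric_mixed_3_structure X A \<phi> \<xi> \<eta> g"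
    and "immersed_submanifold X A Y B f"
    and "nondegenerate_submanifold A g Y B f"
    and "invariant_submanifold A \<phi> Y B f"
  shows "(\<forall>\<alpha>\<in>{1, 2, 3}. tangent_to A Y B f (\<xi> \<alpha>)) \<or> (\<forall>\<alpha>\<in>{1, 2, 3}. normal_to A g Y B f (\<xi> \<alpha>))"
proof -
  interpret metric_mixed_3_structure X A \<phi> \<xi> \<eta> g by fact
  interpret immersed_submanifold X A Y B f by fact
  let ?n = "dim (UNIV :: 'f set)"
  \<comment> \<open>Each alternative is tied to the parity of \<open>?n\<close>, which does not
    depend on \<open>q\<close>; hence all points, across all components, fall into the same
    case.\<close>
  have pointwise:
    "(odd ?n \<and> (\<forall>\<alpha>\<in>{1, 2, 3}. \<xi> \<alpha> (f q) \<in> sub_tangent A B f q)) \<or>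
     (even ?n \<and> (\<forall>\<alpha>\<in>{1, 2, 3}. \<xi> \<alpha> (f q) \<in> sub_normal A g B f q))"
    if q: "q \<in> topspace Y" for q
  proof -
    let ?V = "sub_tangent A B f q"
    have p: "f q \<in> topspace X"
      using smooth_immersion q unfolding smooth_map_def continuous_map_def by blast
    obtain L :: "'f \<Rightarrow> ('a, 'e) tvec" where L: "linear L" "inj L" "?V = range L"
      "range L \<subseteq> tangent_space A (f q)"
      using sub_tangent_eq_range_linear_inj[OF q] .
    have V: "subspace ?V" "?V \<subseteq> tangent_space A (f q)"
      using L linear_subspace_image[OF L(1) subspace_UNIV] by auto
    have dim: "dim ?V = ?n"
      using dim_range_linear_inj[OF L(1,2)] L(3) by simp
    obtain C :: "'f set" where C: "finite C" "span C = UNIV"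
      using finite_spanning_set .
    have LC: "finite (L ` C)" "?V \<subseteq> span (L ` C)"
      using C L(3) linear_span_image[OF L(1), of C] by auto
    have inv: "\<And>\<alpha> v. \<alpha> \<in> {1, 2, 3} \<Longrightarrow> v \<in> ?V \<Longrightarrow> \<phi> \<alpha> (f q) v \<in> ?V"
      using assms(4) q unfolding invariant_submanifold_def by blast
    have inv3: "\<And>v. v \<in> ?V \<Longrightarrow> \<phi> 3 (f q) v \<in> ?V"
      using inv by blast
    note parity = invariant_subspace_parity[OF p V LC inv3, unfolded dim]
    from invariant_subspace_xi_or_eta[OF p V inv] show ?thesis
    proof
      assume "\<forall>\<alpha>\<in>{1, 2, 3}. \<xi> \<alpha> (f q) \<in> ?V"
      moreover from this have "odd ?n" using parity(1) by simp
      ultimately show ?thesis by simp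
    next
      assume \<eta>: "\<forall>\<alpha>\<in>{1, 2, 3}. \<forall>v\<in>?V. \<eta> \<alpha> (f q) v = 0"
      have "\<xi> \<alpha> (f q) \<in> sub_normal A g B f q" if \<alpha>: "\<alpha> \<in> {1, 2, 3}" for \<alpha>
      proof -
        have "g (f q) (\<xi> \<alpha> (f q)) v = 0" if v: "v \<in> ?V" for v
          using eta_eq_metric_xi[OF \<alpha> p subsetD[OF V(2) v]] bspec[OF bspec[OF \<eta> \<alpha>] v] by simp
        then show ?thesis
          using xi_in_tangent_space[OF \<alpha> p] by (simp add: sub_normal_def)
      qed
      moreover have "even ?n" using parity(2) \<eta> by simp
      ultimately show ?thesis by simp
    qed
  qed
  show ?thesis
  proof (cases "odd ?n")
    case True
    with pointwise show ?thesis by (simp add: tangent_to_def)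
  next
    case False
    with pointwise show ?thesis by (simp add: normal_to_def)
  qed
qed

end
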